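(* Solutions of the Riccati equation $\Theta'(x)+\Theta^2(x)+h(x)=0$ with any real-valued $h$ of class $C^1$ are geodesic curves in two-dimensional anti-de Sitter geometry. More precisely: let $h:\mathbb{R}\to\mathbb{R}$ be of class $C^1$ and let $\Psi$ be a positive real-valued function on an interval $]x_-,x_+[$ such that $h(x)\neq-\Psi^2(x)$ on $]x_-,x_+[$. If either $\Theta=\Psi$ or $\Theta=-\Psi$ is a solution of $$\Theta'(x)+\Theta^2(x)+h(x)=0$$ on $]x_-,x_+[$, then $\Psi$ is a solution on $]x_-,x_+[$ of $$\Psi''(x)=\frac{3\Psi^{2}(x)-h(x)}{\Psi^{2}(x)+h(x)}\,\frac{[\Psi'(x)]^{2}}{\Psi(x)}+\frac{h'(x)\Psi'(x)}{\Psi^{2}(x)+h(x)}-\frac{\Psi^{4}(x)-h^{2}(x)}{\Psi(x)}.$$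
   Context: The displayed second order equation for $\Psi$ is the equation of geodesic curves in explicit form on the Lorentzian manifold $\widetilde{\mathbb M}_h^+=(\widetilde{\mathcal H}_0,\widetilde g_h)$, where $\widetilde{\mathcal H}_0=\{(x,\varPsi)\in\mathbb{R}\times\mathbb{R}_{>0}:\varPsi^2\neq-h(x)\}$ and $\widetilde g_h=\varPsi^{-2}\left[-(h(x)+\varPsi^2)^2dx^2+d\varPsi^2\right]$, which is locally two-dimensional anti-de Sitter space. Here "explicit form" means: for a geodesic $s\mapsto(x(s),\varPsi(s))$ with $\dot x(s)\neq0$ on an interval around $s=0$, one writes $\varPsi(s)=\Psi(x(s))$. *)

theory Defs
  imports "HOL-Analysis.Analysis"
begin

text \<open>
  A pseudo-Riemannian metric on an open set of coordinate space is given by its component matrix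
  \<open>g p $ i $ j\<close> at the point \<open>p\<close>. The connection coefficients below are those of the
  Levi-Civita connection of \<open>g\<close>.
\<close>

definition partial_deriv :: "'n::finite \<Rightarrow> (real^'n \<Rightarrow> real) \<Rightarrow> real^'n \<Rightarrow> real" where
  "partial_deriv i f p = deriv (\<lambda>t. f (p + t *\<^sub>R axis i 1)) 0"

definition christoffel ::
    "(real^'n \<Rightarrow> real^'n^'n) \<Rightarrow> 'n::finite \<Rightarrow> 'n \<Rightarrow> 'n \<Rightarrow> real^'n \<Rightarrow> real" where
  "christoffel g k i j p =
     (1/2) * (\<Sum>l\<in>UNIV. matrix_inv (g p) $ k $ l *
        (partial_deriv i (\<lambda>q. g q $ j $ l) p
         + partial_deriv j (\<lambda>q. g q $ i $ l) p
         - partial_deriv l (\<lambda>q. g q $ i $ j) p))"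

definition geodesic_on ::
    "(real^'n) set \<Rightarrow> (real^'n \<Rightarrow> real^'n^'n) \<Rightarrow> (real \<Rightarrow> real^'n::finite) \<Rightarrow> real set \<Rightarrow> bool" where
  "geodesic_on M g \<gamma> J \<longleftrightarrow>
     (\<forall>s\<in>J. \<gamma> s \<in> M
        \<and> \<gamma> differentiable (at s)
        \<and> (\<lambda>r. vector_derivative \<gamma> (at r)) differentiable (at s)
        \<and> (\<forall>k. vector_derivative (\<lambda>r. vector_derivative \<gamma> (at r)) (at s) $ k
             + (\<Sum>i\<in>UNIV. \<Sum>j\<in>UNIV. christoffel g k i j (\<gamma> s)
                  * vector_derivative \<gamma> (at s) $ i * vector_derivative \<gamma> (at s) $ j) = 0))"

text \<open>
  The graph of \<open>\<Psi>\<close> over the open interval \<open>I\<close> is a geodesic written in explicit form: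
  there is a geodesic \<open>s \<mapsto> (x s, \<psi> s)\<close>, on an open interval around \<open>s = 0\<close>, with nowhere
  vanishing \<open>x\<close>-velocity and \<open>\<psi> s = \<Psi> (x s)\<close>, whose \<open>x\<close>-coordinate runs through all of \<open>I\<close>.
  Geodesics are affinely parametrized and may be null.
\<close>

definition explicit_geodesic_on ::
    "(real^2) set \<Rightarrow> (real^2 \<Rightarrow> real^2^2) \<Rightarrow> (real \<Rightarrow> real) \<Rightarrow> real set \<Rightarrow> bool" where
  "explicit_geodesic_on M g \<Psi> I \<longleftrightarrow>
     (\<exists>J x. open J \<and> is_interval J \<and> 0 \<in> J \<and> x ` J = I
        \<and> (\<forall>s\<in>J. deriv x s \<noteq> 0)
        \<and> geodesic_on M g (\<lambda>s. vector [x s, \<Psi> (x s)]) J)"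

definition ads_domain :: "(real \<Rightarrow> real) \<Rightarrow> (real^2) set" where
  "ads_domain h = {p. p $ 2 > 0 \<and> (p $ 2)\<^sup>2 \<noteq> - h (p $ 1)}"

definition ads_metric :: "(real \<Rightarrow> real) \<Rightarrow> real^2 \<Rightarrow> real^2^2" where
  "ads_metric h p =
     (1 / (p $ 2)\<^sup>2) *\<^sub>R vector [vector [- (h (p $ 1) + (p $ 2)\<^sup>2)\<^sup>2, 0], vector [0, 1]]"

definition riccati_solution_on :: "(real \<Rightarrow> real) \<Rightarrow> (real \<Rightarrow> real) \<Rightarrow> real set \<Rightarrow> bool" where
  "riccati_solution_on h \<Theta> I \<longleftrightarrow>
     (\<forall>x\<in>I. \<Theta> differentiable (at x) \<and> deriv \<Theta> x + (\<Theta> x)\<^sup>2 + h x = 0)"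

definition second_order_solution_on :: "(real \<Rightarrow> real) \<Rightarrow> (real \<Rightarrow> real) \<Rightarrow> real set \<Rightarrow> bool" where
  "second_order_solution_on h \<Psi> I \<longleftrightarrow>
     (\<forall>x\<in>I. \<Psi> differentiable (at x) \<and> deriv \<Psi> differentiable (at x)
        \<and> deriv (deriv \<Psi>) x =
            (3 * (\<Psi> x)\<^sup>2 - h x) / ((\<Psi> x)\<^sup>2 + h x) * ((deriv \<Psi> x)\<^sup>2 / \<Psi> x)
            + deriv h x * deriv \<Psi> x / ((\<Psi> x)\<^sup>2 + h x)
            - ((\<Psi> x)^4 - (h x)\<^sup>2) / \<Psi> x)"

end

theory Submission
  imports Defs "HOL-Complex_Analysis.Conformal_Mappings"
begin

text \<open>
  Writing \<open>F = \<Psi>\<^sup>2 + h\<close>, the Riccati equation for \<open>\<plusminus>\<Psi>\<close> reads \<open>\<Psi>' = \<sigma> F\<close> with \<open>\<sigma> = \<minusplus>1\<close>, so the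
  graph of \<open>\<Psi>\<close> is a null curve; in two dimensions null curves are geodesics up to
  reparametrization. With \<open>P' = \<Psi>\<close>, the geodesic equation for a curve \<open>(x, \<Psi> x)\<close> holds if
  \<open>x' = v(x)\<close> with \<open>v = \<Psi>\<^sup>2 exp (- 2 \<sigma> P) / F\<close>. An affine parameter is therefore an
  antiderivative of \<open>1 / v\<close>, which maps the interval diffeomorphically onto another interval.
\<close>

section \<open>Matrix inverses and derivatives of plane curves\<close>

lemma matrix_inv_eqI:
  fixes A B :: "'a::semiring_1^'n^'n"
  assumes "A ** B = mat 1" "B ** A = mat 1"
  shows "matrix_inv A = B"
proof -
  have "A ** matrix_inv A = mat 1 \<and> matrix_inv A ** A = mat 1"
    unfolding matrix_inv_def by (rule someI_ex) (use assms in blast)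
  then show ?thesis
    using assms by (metis matrix_mul_assoc matrix_mul_lid matrix_mul_rid)
qed

text \<open>In the standard basis the vector becomes a sum of scalar multiples of constants, a form
  that the derivative rules can handle.\<close>

lemma vector_2_eq: "vector [a, b] = a *\<^sub>R axis 1 1 + b *\<^sub>R (axis 2 1 :: real^2)"
  by (simp add: vec_eq_iff forall_2 axis_def)

lemma has_vector_derivative_vector_2:
  assumes "(f has_real_derivative f') (at s)" "(g has_real_derivative g') (at s)"
  shows "((\<lambda>r. vector [f r, g r] :: real^2) has_vector_derivative vector [f', g']) (at s)"
  unfolding vector_2_eq using assms
  by (auto intro!: derivative_eq_intros)

section \<open>Autonomous first order equations on an interval\<close>

text \<open>Separation of variables: the inverse of an antiderivative of \<open>w\<close> solves
  \<open>x' = 1 / w x\<close>. Taking the image of the whole interval as time domain makes the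
  solution sweep out every point.\<close>

lemma exists_flow_on_einterval:
  fixes w :: "real \<Rightarrow> real" and a b :: ereal
  assumes "a < b"
    and cont: "\<And>x. x \<in> einterval a b \<Longrightarrow> isCont w x"
    and nz: "\<And>x. x \<in> einterval a b \<Longrightarrow> w x \<noteq> 0"
  shows "\<exists>J x. open J \<and> is_interval J \<and> 0 \<in> J \<and> x ` J = einterval a b
           \<and> (\<forall>s\<in>J. (x has_real_derivative inverse (w (x s))) (at s))"
proof -
  define I where "I = einterval a b"
  have opI: "open I" by (simp add: I_def)
  have intI: "is_interval I" by (auto simp: I_def is_interval_1 einterval_def intro: less_le_trans)
      (meson ereal_less_eq(3) le_less_trans)
  obtain c where c: "c \<in> I"
    using einterval_nonempty[OF \<open>a < b\<close>] by (auto simp: I_def)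
  obtain S0 where S0: "\<And>x. x \<in> I \<Longrightarrow> (S0 has_vector_derivative w x) (at x)"
    using einterval_antiderivative[OF \<open>a < b\<close>, of w] cont by (auto simp: I_def einterval_def)
  \<comment> \<open>Subtracting the value at a base point \<open>c\<close> puts time 0 into the
    image.\<close>
  define S where "S x = S0 x - S0 c" for x
  have S: "(S has_real_derivative w x) (at x)" if "x \<in> I" for x
    unfolding S_def using S0[OF that]
    by (auto intro!: derivative_eq_intros simp: has_real_derivative_iff_has_vector_derivative)
  have contS: "continuous_on I S"
    using S by (meson DERIV_isCont continuous_at_imp_continuous_on)
  \<comment> \<open>By the mean value theorem, equal values would force a zero of \<open>w\<close>
    in between; this avoids discussing the sign of \<open>w\<close>.\<close>
  have S_neq: "S x \<noteq> S y" if xy: "x \<in> I" "y \<in> I" "x < y" for x y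
  proof
    assume eq: "S x = S y"
    have sub: "{x..y} \<subseteq> I"
      using intI xy by (meson atLeastAtMost_iff is_interval_1 subsetI)
    obtain z where z: "x < z" "z < y" "S y - S x = (y - x) * w z"
      using MVT2[OF \<open>x < y\<close>, of S w] S sub by (meson atLeastAtMost_iff subsetD)
    then have "z \<in> I" using sub by auto
    then show False using z eq nz \<open>x < y\<close> by (auto simp: I_def)
  qed
  have inj: "inj_on S I"
    by (rule inj_onI) (metis S_neq linorder_less_linear)
  define J where "J = S ` I"
  define X where "X = the_inv_into I S"
  have XS: "X (S x) = x" if "x \<in> I" for x
    using inj that by (simp add: X_def the_inv_into_f_f)
  have "open J"
    unfolding J_def using contS opI inj by (rule invariance_of_domain)
  moreover have "is_interval J"
    using contS intI unfolding J_def
    by (metis connected_continuous_image is_interval_connected_1)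
  moreover have "0 \<in> J"
    unfolding J_def using c by (auto simp: S_def intro!: image_eqI[of _ _ c])
  moreover have "X ` J = I"
    using XS by (force simp: J_def)
  moreover have "(X has_real_derivative inverse (w (X s))) (at s)" if s: "s \<in> J" for s
  proof -
    obtain x where x: "x \<in> I" "s = S x" using s by (auto simp: J_def)
    show ?thesis
      using has_field_derivative_inverse_strong[OF S[OF x(1)] _ opI x(1) contS, of X] XS nz x
      by (auto simp: I_def)
  qed
  ultimately show ?thesis unfolding I_def by blast
qed

section \<open>The Levi-Civita connection of the metric\<close>

lemma ads_metric_components [simp]:
  "ads_metric h p $ 1 $ 1 = - (h (p $ 1) + (p $ 2)\<^sup>2)\<^sup>2 / (p $ 2)\<^sup>2"
  "ads_metric h p $ 1 $ 2 = 0"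
  "ads_metric h p $ 2 $ 1 = 0"
  "ads_metric h p $ 2 $ 2 = 1 / (p $ 2)\<^sup>2"
  by (simp_all add: ads_metric_def)

lemma matrix_inv_ads_metric:
  assumes "p \<in> ads_domain h"
  shows "matrix_inv (ads_metric h p) =
    vector [vector [- (p $ 2)\<^sup>2 / (h (p $ 1) + (p $ 2)\<^sup>2)\<^sup>2, 0], vector [0, (p $ 2)\<^sup>2]]"
proof -
  have "h (p $ 1) + (p $ 2)\<^sup>2 \<noteq> 0" "p $ 2 \<noteq> 0"
    using assms by (auto simp: ads_domain_def)
  then show ?thesis
    by (intro matrix_inv_eqI)
       (simp_all add: vec_eq_iff forall_2 matrix_matrix_mult_def sum_2 mat_def)
qed

lemma partial_derivs_ads_metric:
  fixes p :: "real^2"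
  assumes p: "p \<in> ads_domain h" and h: "(h has_real_derivative h') (at (p $ 1))"
  defines "y \<equiv> p $ 2"
  defines "F \<equiv> h (p $ 1) + y\<^sup>2"
  shows "partial_deriv 1 (\<lambda>q. ads_metric h q $ 1 $ 1) p = - 2 * F * h' / y\<^sup>2"
    and "partial_deriv 2 (\<lambda>q. ads_metric h q $ 1 $ 1) p = - 4 * F / y + 2 * F\<^sup>2 / y ^ 3"
    and "partial_deriv 1 (\<lambda>q. ads_metric h q $ 2 $ 2) p = 0"
    and "partial_deriv 2 (\<lambda>q. ads_metric h q $ 2 $ 2) p = - 2 / y ^ 3"
    and "partial_deriv i (\<lambda>q. ads_metric h q $ 1 $ 2) p = 0"
    and "partial_deriv i (\<lambda>q. ads_metric h q $ 2 $ 1) p = 0"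
proof -
  have y: "y \<noteq> 0" using p by (auto simp: ads_domain_def y_def)
  \<comment> \<open>Partial derivatives are taken at parameter 0 of a coordinate line, so the
    derivative of \<open>h\<close> is moved there.\<close>
  have h0: "((\<lambda>t. h (p $ 1 + t)) has_real_derivative h') (at 0)"
    using DERIV_shift[of h h' 0 "p $ 1"] h by (simp add: add.commute)
  show "partial_deriv 1 (\<lambda>q. ads_metric h q $ 1 $ 1) p = - 2 * F * h' / y\<^sup>2"
    unfolding partial_deriv_def F_def y_def using h0 y
    by (intro DERIV_imp_deriv)
       (auto simp: axis_def y_def field_simps eval_nat_numeral intro!: derivative_eq_intros)
  show "partial_deriv 2 (\<lambda>q. ads_metric h q $ 1 $ 1) p = - 4 * F / y + 2 * F\<^sup>2 / y ^ 3"
    unfolding partial_deriv_def F_def y_def using y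
    by (intro DERIV_imp_deriv)
       (auto simp: axis_def y_def field_simps eval_nat_numeral intro!: derivative_eq_intros)
  show "partial_deriv 1 (\<lambda>q. ads_metric h q $ 2 $ 2) p = 0"
    by (simp add: partial_deriv_def axis_def)
  show "partial_deriv 2 (\<lambda>q. ads_metric h q $ 2 $ 2) p = - 2 / y ^ 3"
    unfolding partial_deriv_def y_def using y
    by (intro DERIV_imp_deriv)
       (auto simp: axis_def y_def field_simps eval_nat_numeral intro!: derivative_eq_intros)
  show "partial_deriv i (\<lambda>q. ads_metric h q $ 1 $ 2) p = 0"
    "partial_deriv i (\<lambda>q. ads_metric h q $ 2 $ 1) p = 0"
    by (simp_all add: partial_deriv_def)
qed

text \<open>The metric and its inverse are diagonal, so in the sum over \<open>l\<close> only
  \<open>l = k\<close> contributes. With \<open>g11 = - F\<^sup>2 / y\<^sup>2\<close> and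
  \<open>g22 = 1 / y\<^sup>2\<close>, the symbol with indices 1, 1, 2 is half the logarithmic
  \<open>y\<close>-derivative of \<open>g11\<close>.\<close>

lemma christoffel_ads_metric:
  fixes p :: "real^2"
  assumes p: "p \<in> ads_domain h" and h: "(h has_real_derivative h') (at (p $ 1))"
  defines "y \<equiv> p $ 2"
  defines "F \<equiv> h (p $ 1) + y\<^sup>2"
  shows "christoffel (ads_metric h) 1 1 1 p = h' / F"
    and "christoffel (ads_metric h) 1 1 2 p = 2 * y / F - 1 / y"
    and "christoffel (ads_metric h) 1 2 1 p = 2 * y / F - 1 / y"
    and "christoffel (ads_metric h) 1 2 2 p = 0"
    and "christoffel (ads_metric h) 2 1 1 p = 2 * y * F - F\<^sup>2 / y"
    and "christoffel (ads_metric h) 2 1 2 p = 0"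
    and "christoffel (ads_metric h) 2 2 1 p = 0"
    and "christoffel (ads_metric h) 2 2 2 p = - 1 / y"
proof -
  have nz: "y \<noteq> 0" "F \<noteq> 0" using p by (auto simp: ads_domain_def y_def F_def)
  note * = christoffel_def sum_2 matrix_inv_ads_metric[OF p] partial_derivs_ads_metric[OF p h]
    y_def[symmetric] F_def[symmetric]
  show "christoffel (ads_metric h) 1 1 1 p = h' / F"
    "christoffel (ads_metric h) 1 1 2 p = 2 * y / F - 1 / y"
    "christoffel (ads_metric h) 1 2 1 p = 2 * y / F - 1 / y"
    "christoffel (ads_metric h) 1 2 2 p = 0"
    "christoffel (ads_metric h) 2 1 1 p = 2 * y * F - F\<^sup>2 / y"
    "christoffel (ads_metric h) 2 1 2 p = 0"
    "christoffel (ads_metric h) 2 2 1 p = 0"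
    "christoffel (ads_metric h) 2 2 2 p = - 1 / y"
    unfolding * using nz by (simp_all add: field_simps eval_nat_numeral)
qed

section \<open>Consequences of the Riccati equation\<close>

text \<open>The first order equation holds on an open set, so its right-hand side can be
  differentiated in place of \<open>deriv \<Psi>\<close>; this is where second differentiability of
  \<open>\<Psi>\<close> comes from.\<close>

lemma riccati_second_derivative:
  fixes h \<Psi> :: "real \<Rightarrow> real"
  assumes I: "open I" "x \<in> I" and h: "(h has_real_derivative h') (at x)"
    and ric: "\<And>x. x \<in> I \<Longrightarrow> (\<Psi> has_real_derivative \<sigma> * ((\<Psi> x)\<^sup>2 + h x)) (at x)"
  shows "(deriv \<Psi> has_real_derivative
    \<sigma> * (2 * \<Psi> x * (\<sigma> * ((\<Psi> x)\<^sup>2 + h x)) + h')) (at x)"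
proof (rule has_field_derivative_transform_within_open[OF _ I])
  show "((\<lambda>x. \<sigma> * ((\<Psi> x)\<^sup>2 + h x)) has_real_derivative
      \<sigma> * (2 * \<Psi> x * (\<sigma> * ((\<Psi> x)\<^sup>2 + h x)) + h')) (at x)"
    using ric[OF I(2)] h by (auto intro!: derivative_eq_intros)
  show "\<sigma> * ((\<Psi> z)\<^sup>2 + h z) = deriv \<Psi> z" if "z \<in> I" for z
    using ric[OF that] by (simp add: DERIV_imp_deriv)
qed

lemma second_order_solution_on_riccati:
  fixes h \<Psi> :: "real \<Rightarrow> real"
  assumes "open I" and h: "\<And>x. x \<in> I \<Longrightarrow> (h has_real_derivative deriv h x) (at x)"
    and pos: "\<And>x. x \<in> I \<Longrightarrow> \<Psi> x > 0"
    and nz: "\<And>x. x \<in> I \<Longrightarrow> (\<Psi> x)\<^sup>2 + h x \<noteq> 0"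
    and \<sigma>: "\<sigma>\<^sup>2 = 1"
    and ric: "\<And>x. x \<in> I \<Longrightarrow> (\<Psi> has_real_derivative \<sigma> * ((\<Psi> x)\<^sup>2 + h x)) (at x)"
  shows "second_order_solution_on h \<Psi> I"
  unfolding second_order_solution_on_def
proof (intro ballI conjI)
  fix x assume x: "x \<in> I"
  have D2: "(deriv \<Psi> has_real_derivative
      \<sigma> * (2 * \<Psi> x * (\<sigma> * ((\<Psi> x)\<^sup>2 + h x)) + deriv h x)) (at x)"
    using \<open>open I\<close> x h[OF x] ric by (rule riccati_second_derivative)
  show "\<Psi> differentiable at x" "deriv \<Psi> differentiable at x"
    using ric[OF x] D2 by (auto simp: real_differentiable_def)
  define y F where "y = \<Psi> x" and "F = (\<Psi> x)\<^sup>2 + h x"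
  have hx: "h x = F - y\<^sup>2" and y: "y \<noteq> 0" and F: "F \<noteq> 0"
    using pos[OF x] nz[OF x] by (auto simp: F_def y_def)
  \<comment> \<open>Put \<open>\<Psi>' = \<sigma> * F\<close> into the right-hand side. Since
    \<open>y ^ 4 - (h x)\<^sup>2 = (y\<^sup>2 - h x) * F\<close>, the first and last terms combine
    to \<open>2 * y * F\<close>.\<close>
  have "(3 * y\<^sup>2 - h x) / F * ((\<sigma> * F)\<^sup>2 / y) + deriv h x * (\<sigma> * F) / F - (y ^ 4 - (h x)\<^sup>2) / y
      = (3 * y\<^sup>2 - h x) * F / y + \<sigma> * deriv h x - (y\<^sup>2 - h x) * F / y"
    using y F \<sigma> by (simp add: hx power_mult_distrib field_simps eval_nat_numeral)
  also have "\<dots> = 2 * y * F * \<sigma>\<^sup>2 + \<sigma> * deriv h x"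
    using y \<sigma> by (simp add: field_simps eval_nat_numeral)
  finally show "deriv (deriv \<Psi>) x =
            (3 * (\<Psi> x)\<^sup>2 - h x) / ((\<Psi> x)\<^sup>2 + h x) * ((deriv \<Psi> x)\<^sup>2 / \<Psi> x)
            + deriv h x * deriv \<Psi> x / ((\<Psi> x)\<^sup>2 + h x)
            - ((\<Psi> x)^4 - (h x)\<^sup>2) / \<Psi> x"
    unfolding DERIV_imp_deriv[OF D2] DERIV_imp_deriv[OF ric[OF x]] y_def F_def
    by (simp add: algebra_simps power2_eq_square)
qed

text \<open>Along the graph, the first geodesic equation prescribes the logarithmic derivative of
  the speed \<open>v\<close> as a function of \<open>x\<close>. Once it holds, the second one
  reduces to \<open>\<sigma>\<^sup>2 = 1\<close>.\<close>

lemma explicit_geodesic_on_riccati: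
  fixes h \<Psi> :: "real \<Rightarrow> real" and a b :: ereal
  defines "I \<equiv> einterval a b"
  assumes "a < b" and h: "\<And>x. x \<in> I \<Longrightarrow> (h has_real_derivative deriv h x) (at x)"
    and pos: "\<And>x. x \<in> I \<Longrightarrow> \<Psi> x > 0"
    and nz: "\<And>x. x \<in> I \<Longrightarrow> (\<Psi> x)\<^sup>2 + h x \<noteq> 0"
    and \<sigma>: "\<sigma>\<^sup>2 = 1"
    and ric: "\<And>x. x \<in> I \<Longrightarrow> (\<Psi> has_real_derivative \<sigma> * ((\<Psi> x)\<^sup>2 + h x)) (at x)"
  shows "explicit_geodesic_on (ads_domain h) (ads_metric h) \<Psi> I"
proof -
  define F where "F x = (\<Psi> x)\<^sup>2 + h x" for x
  note ric' = ric[folded F_def]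
  obtain P where P: "\<And>x. x \<in> I \<Longrightarrow> (P has_real_derivative \<Psi> x) (at x)"
    using einterval_antiderivative[OF \<open>a < b\<close>, of \<Psi>] DERIV_isCont[OF ric]
    by (auto simp: I_def einterval_def has_real_derivative_iff_has_vector_derivative)
  define v where "v x = (\<Psi> x)\<^sup>2 * exp (- 2 * \<sigma> * P x) / F x" for x
  have vnz: "v x \<noteq> 0" if "x \<in> I" for x
    using pos[OF that] nz[OF that] by (auto simp: v_def F_def)
  \<comment> \<open>This is \<open>v\<close> times its logarithmic derivative
    \<open>2 * \<Psi>' / \<Psi> - 2 * \<sigma> * \<Psi> - F' / F\<close>, with
    \<open>\<Psi>' = \<sigma> * F\<close> and \<open>F' = 2 * \<Psi> * \<sigma> * F + h'\<close>
    inserted. The exponential survives only inside the factor \<open>v\<close>.\<close>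
  define v' where "v' x = - v x * (deriv h x / F x + 2 * \<sigma> * (2 * \<Psi> x - F x / \<Psi> x))" for x
  have dF: "(F has_real_derivative 2 * \<Psi> x * (\<sigma> * F x) + deriv h x) (at x)" if "x \<in> I" for x
    unfolding F_def using ric[OF that] h[OF that] by (auto intro!: derivative_eq_intros)
  have dv: "(v has_real_derivative v' x) (at x)" if x: "x \<in> I" for x
  proof -
    have "F x \<noteq> 0" "\<Psi> x \<noteq> 0" using pos[OF x] nz[OF x] by (auto simp: F_def)
    then show ?thesis
      unfolding v_def[abs_def]
      by (auto intro!: derivative_eq_intros ric'[OF x] dF[OF x] P[OF x])
         (simp add: v'_def v_def field_simps eval_nat_numeral)
  qed
  have cont: "isCont (\<lambda>x. inverse (v x)) x" if "x \<in> I" for x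
    using DERIV_isCont[OF dv[OF that]] vnz[OF that] by (intro continuous_intros) auto
  \<comment> \<open>The flow lemma is applied to the reciprocal of \<open>v\<close>, so the two
    inversions cancel and the resulting velocity is \<open>v\<close>.\<close>
  obtain J X where J: "open J" "is_interval J" "0 \<in> J" "X ` J = I"
    and X: "\<And>s. s \<in> J \<Longrightarrow> (X has_real_derivative v (X s)) (at s)"
    using exists_flow_on_einterval[OF \<open>a < b\<close>, of "\<lambda>x. inverse (v x)"] cont vnz
    unfolding I_def by auto
  define \<gamma> :: "real \<Rightarrow> real^2" where "\<gamma> s = vector [X s, \<Psi> (X s)]" for s
  define V :: "real \<Rightarrow> real^2" where "V s = vector [v (X s), \<sigma> * F (X s) * v (X s)]" for s
  have XI: "X s \<in> I" if "s \<in> J" for s using J that by blast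
  have comp: "((\<lambda>s. f (X s)) has_real_derivative f' * v (X s)) (at s)"
    if "s \<in> J" "(f has_real_derivative f') (at (X s))" for f f' s
    using DERIV_chain2[OF that(2) X[OF that(1)]] .
  have d\<gamma>: "(\<gamma> has_vector_derivative V s) (at s)" if s: "s \<in> J" for s
    unfolding \<gamma>_def[abs_def] V_def
    by (intro has_vector_derivative_vector_2 X comp s ric' XI)
  have vd: "vector_derivative \<gamma> (at s) = V s" if "s \<in> J" for s
    using d\<gamma>[OF that] by (rule vector_derivative_at)
  have geo: "geodesic_on (ads_domain h) (ads_metric h) \<gamma> J"
    unfolding geodesic_on_def
  proof (intro ballI conjI)
    fix s assume s: "s \<in> J"
    define x where "x = X s"
    have x: "x \<in> I" using XI[OF s] by (simp add: x_def)
    have F: "F x \<noteq> 0" and \<Psi>: "\<Psi> x \<noteq> 0" using pos[OF x] nz[OF x] by (auto simp: F_def)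
    show dom: "\<gamma> s \<in> ads_domain h"
      using pos[OF x] nz[OF x] by (auto simp: ads_domain_def \<gamma>_def x_def[symmetric])
    show "\<gamma> differentiable at s"
      using d\<gamma>[OF s] by (rule differentiableI_vector)
    \<comment> \<open>The acceleration: chain rule for \<open>v (X s)\<close> and product rule for
      \<open>\<sigma> * F (X s) * v (X s)\<close>, each derivative in \<open>x\<close> picking up a
      factor \<open>v x\<close>.\<close>
    define A :: "real^2" where "A = vector [v' x * v x,
      \<sigma> * (2 * \<Psi> x * (\<sigma> * F x) + deriv h x) * v x * v x + v' x * v x * (\<sigma> * F x)]"
    have "(V has_vector_derivative A) (at s)"
      unfolding V_def[abs_def] A_def
      by (intro has_vector_derivative_vector_2; unfold x_def)
         (auto intro!: derivative_eq_intros comp[OF s dv[OF XI[OF s]]] comp[OF s dF[OF XI[OF s]]])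
    \<comment> \<open>The velocity field is known to be \<open>V\<close> only on \<open>J\<close>;
      openness of \<open>J\<close> lets the derivative be transferred.\<close>
    then have dV: "((\<lambda>r. vector_derivative \<gamma> (at r)) has_vector_derivative A) (at s)"
      by (rule has_vector_derivative_transform_within_open[OF _ \<open>open J\<close> s]) (simp add: vd)
    then show "(\<lambda>r. vector_derivative \<gamma> (at r)) differentiable at s"
      by (rule differentiableI_vector)
    have h': "(h has_real_derivative deriv h x) (at (\<gamma> s $ 1))"
      using h[OF x] by (simp add: \<gamma>_def x_def)
    have \<gamma>s: "\<gamma> s $ 1 = x" "\<gamma> s $ 2 = \<Psi> x" "h x + (\<Psi> x)\<^sup>2 = F x"
      by (simp_all add: \<gamma>_def x_def F_def)
    have Vs: "V s $ 1 = v x" "V s $ 2 = \<sigma> * F x * v x"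
      by (simp_all add: V_def x_def)
    have "v' x * v x + deriv h x / F x * (v x)\<^sup>2
        + 2 * ((2 * \<Psi> x / F x - 1 / \<Psi> x) * v x * (\<sigma> * F x * v x)) = 0"
      using F \<Psi> by (simp add: v'_def field_simps power2_eq_square)
    moreover have "A $ 2 + (2 * \<Psi> x * F x - (F x)\<^sup>2 / \<Psi> x) * (v x)\<^sup>2
        - \<sigma>\<^sup>2 * (F x * v x)\<^sup>2 / \<Psi> x = 0"
    proof -
      \<comment> \<open>The two terms containing \<open>deriv h x\<close> cancel here, so only
        powers of \<open>F\<close> and \<open>\<Psi>\<close> remain.\<close>
      have "A $ 2 = \<sigma>\<^sup>2 * (2 * (F x)\<^sup>2 / \<Psi> x - 2 * \<Psi> x * F x) * (v x)\<^sup>2"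
        using F \<Psi> by (simp add: A_def v'_def field_simps power2_eq_square)
      then show ?thesis unfolding power_mult_distrib \<sigma> using \<Psi> by (simp add: field_simps power2_eq_square)
    qed
    ultimately show "\<forall>k. vector_derivative (\<lambda>r. vector_derivative \<gamma> (at r)) (at s) $ k
             + (\<Sum>i\<in>UNIV. \<Sum>j\<in>UNIV. christoffel (ads_metric h) k i j (\<gamma> s)
                  * vector_derivative \<gamma> (at s) $ i * vector_derivative \<gamma> (at s) $ j) = 0"
      unfolding vector_derivative_at[OF dV] vd[OF s] forall_2 sum_2
        christoffel_ads_metric[OF dom h'] \<gamma>s Vs
      using F by (simp add: A_def algebra_simps power2_eq_square)
  qed
  have "deriv X s \<noteq> 0" if "s \<in> J" for s
    using X[OF that] vnz[OF XI[OF that]] by (simp add: DERIV_imp_deriv)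
  then show ?thesis
    unfolding explicit_geodesic_on_def using J geo unfolding \<gamma>_def[abs_def] by blast
qed

theorem theorem4:
  fixes h \<Psi> :: "real \<Rightarrow> real" and x\<^sub>m x\<^sub>p :: ereal
  assumes "h C1_differentiable_on UNIV"
    and "x\<^sub>m < x\<^sub>p"
    and "\<forall>x\<in>einterval x\<^sub>m x\<^sub>p. \<Psi> x > 0"
    and "\<forall>x\<in>einterval x\<^sub>m x\<^sub>p. h x \<noteq> - (\<Psi> x)\<^sup>2"
    and "riccati_solution_on h \<Psi> (einterval x\<^sub>m x\<^sub>p)
         \<or> riccati_solution_on h (\<lambda>x. - \<Psi> x) (einterval x\<^sub>m x\<^sub>p)"
  shows "second_order_solution_on h \<Psi> (einterval x\<^sub>m x\<^sub>p)
         \<and> explicit_geodesic_on (ads_domain h) (ads_metric h) \<Psi> (einterval x\<^sub>m x\<^sub>p)"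
proof -
  let ?I = "einterval x\<^sub>m x\<^sub>p"
  have h: "(h has_real_derivative deriv h x) (at x)" for x
    using assms(1) unfolding C1_differentiable_on_eq
    by (simp add: DERIV_deriv_iff_real_differentiable)
  have nz: "(\<Psi> x)\<^sup>2 + h x \<noteq> 0" if "x \<in> ?I" for x
    using assms(4) that by (metis add.commute add_eq_0_iff)
  \<comment> \<open>Both alternatives are merged into one equation with a sign: -1 for
    \<open>\<Psi>\<close> itself, 1 for its negative. No case split is needed afterwards.\<close>
  have "\<exists>\<sigma>::real. \<sigma>\<^sup>2 = 1 \<and>
      (\<forall>x\<in>?I. (\<Psi> has_real_derivative \<sigma> * ((\<Psi> x)\<^sup>2 + h x)) (at x))"
    using assms(5)
  proof
    assume r: "riccati_solution_on h \<Psi> ?I"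
    have "(\<Psi> has_real_derivative - 1 * ((\<Psi> x)\<^sup>2 + h x)) (at x)" if "x \<in> ?I" for x
    proof -
      have "(\<Psi> has_real_derivative deriv \<Psi> x) (at x)" "deriv \<Psi> x = - 1 * ((\<Psi> x)\<^sup>2 + h x)"
        using r that by (auto simp: riccati_solution_on_def DERIV_deriv_iff_real_differentiable)
      then show ?thesis by simp
    qed
    then show ?thesis by (intro exI[of _ "- 1"]) auto
  next
    assume r: "riccati_solution_on h (\<lambda>x. - \<Psi> x) ?I"
    have "(\<Psi> has_real_derivative 1 * ((\<Psi> x)\<^sup>2 + h x)) (at x)" if "x \<in> ?I" for x
    proof -
      have "((\<lambda>x. - \<Psi> x) has_real_derivative deriv (\<lambda>x. - \<Psi> x) x) (at x)"
        "deriv (\<lambda>x. - \<Psi> x) x = - ((\<Psi> x)\<^sup>2 + h x)"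
        using r that by (auto simp: riccati_solution_on_def DERIV_deriv_iff_real_differentiable)
      then show ?thesis
        using DERIV_minus[of "\<lambda>x. - \<Psi> x" "- ((\<Psi> x)\<^sup>2 + h x)" x UNIV]
        by (simp add: add.commute)
    qed
    then show ?thesis by (intro exI[of _ 1]) auto
  qed
  then obtain \<sigma> :: real where "\<sigma>\<^sup>2 = 1"
    and "\<And>x. x \<in> ?I \<Longrightarrow> (\<Psi> has_real_derivative \<sigma> * ((\<Psi> x)\<^sup>2 + h x)) (at x)"
    by blast
  then show ?thesis
    using assms(2,3) h nz
    by (intro conjI second_order_solution_on_riccati[of _ h \<Psi> \<sigma>]
        explicit_geodesic_on_riccati[of _ _ h \<Psi> \<sigma>]) auto
qed

end
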